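(* Let $(X,\mathcal{S}(X),\mu)$ be a standard probability space with $\mu$ nonatomic, equipped with a measurable metric $d$ that is $\mu$-compatible and $\mu$-regular. Let $T$ be a measure-preserving transformation on $X$, and suppose that $T$ is restricted pairwise sensitive with sensitivity constant $\delta>0$ and asymptotic rate $a>0$. Let $\mathcal{A}=\{A_1,\ldots,A_k\}$ be a finite measurable partition of $X$ such that $\operatorname{diam} A_i<\delta$ for all $i$, and let $h_\mu(T,\mathcal{A})$ be the metric entropy of $T$ with respect to $\mathcal{A}$. Then $h_\mu(T,\mathcal{A})\ge \frac{1}{a}$.
   Context: The metric $d$ on $X$ is assumed measurable, so that $d$-balls are measurable. $B_r(x)=\{y: d(x,y)<r\}$ is the open ball and $\overline{B_r}(x)=\{y:d(x,y)\le r\}$ the closed ball. $\log$ is the natural logarithm (also in the definition of entropy), and $\mathbb{N}_0=\{0,1,2,\ldots\}$. $d$ is $\mu$-compatible if all nonempty open $d$-balls have positive $\mu$-measure. $d$ is $\mu$-regular if for every $x\in X$ there exists $c>0$ such that $c\,\mu(\overline{B_r}(x))\le \mu(B_r(x))$ for all $r>0$. $T$ is restricted pairwise sensitive with sensitivity constant $\delta>0$ and asymptotic rate $a>0$ if for $\mu\otimes\mu$-a.e. $(x,y)\in X\times X$ there exists $n\in\mathbb{N}_0$ with $n\le -a\log\mu(B_{d(x,y)}(x))$ and $d(T^nx,T^ny)>\delta$ (with the convention $-\log 0=+\infty$). *)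

theory Defs
  imports "HOL-Probability.Probability"
begin

text \<open>Only the underlying space and the sigma-algebra of the measure are constrained here.\<close>

definition standard_borel :: "'a measure \<Rightarrow> bool" where
  "standard_borel M \<longleftrightarrow>
     (\<exists>S. completely_metrizable_space S \<and> second_countable S \<and> topspace S = space M \<and>
          sets M = sigma_sets (space M) {U. openin S U})"

text \<open>Both usual conventions are admitted: a Borel probability measure on a standard Borel
  space, or the completion of one (a Lebesgue space).\<close>

definition standard_prob_space :: "'a measure \<Rightarrow> bool" where
  "standard_prob_space M \<longleftrightarrow>
     prob_space M \<and> (standard_borel M \<or> (\<exists>N. standard_borel N \<and> M = completion N))"

definition nonatomic :: "'a measure \<Rightarrow> bool" where
  "nonatomic M \<longleftrightarrow>
     (\<forall>A\<in>sets M. 0 < emeasure M A \<longrightarrow>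
        (\<exists>B\<in>sets M. B \<subseteq> A \<and> 0 < emeasure M B \<and> emeasure M B < emeasure M A))"

text \<open>Joint measurability of the distance makes all balls centred in the space measurable,
  being defined by sections of a measurable function.\<close>

definition measurable_metric :: "'a measure \<Rightarrow> ('a \<Rightarrow> 'a \<Rightarrow> real) \<Rightarrow> bool" where
  "measurable_metric M d \<longleftrightarrow>
     Metric_space (space M) d \<and> (\<lambda>(x, y). d x y) \<in> borel_measurable (M \<Otimes>\<^sub>M M)"

abbreviation open_ball :: "'a measure \<Rightarrow> ('a \<Rightarrow> 'a \<Rightarrow> real) \<Rightarrow> 'a \<Rightarrow> real \<Rightarrow> 'a set" where
  "open_ball M d \<equiv> Metric_space.mball (space M) d"

abbreviation closed_ball :: "'a measure \<Rightarrow> ('a \<Rightarrow> 'a \<Rightarrow> real) \<Rightarrow> 'a \<Rightarrow> real \<Rightarrow> 'a set" where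
  "closed_ball M d \<equiv> Metric_space.mcball (space M) d"

definition compatible_metric :: "'a measure \<Rightarrow> ('a \<Rightarrow> 'a \<Rightarrow> real) \<Rightarrow> bool" where
  "compatible_metric M d \<longleftrightarrow>
     (\<forall>x\<in>space M. \<forall>r. open_ball M d x r \<noteq> {} \<longrightarrow> 0 < measure M (open_ball M d x r))"

definition regular_metric :: "'a measure \<Rightarrow> ('a \<Rightarrow> 'a \<Rightarrow> real) \<Rightarrow> bool" where
  "regular_metric M d \<longleftrightarrow>
     (\<forall>x\<in>space M. \<exists>c>0. \<forall>r>0.
        c * measure M (closed_ball M d x r) \<le> measure M (open_ball M d x r))"

definition measure_preserving_map :: "'a measure \<Rightarrow> ('a \<Rightarrow> 'a) \<Rightarrow> bool" where
  "measure_preserving_map M T \<longleftrightarrow>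
     T \<in> measurable M M \<and> (\<forall>B\<in>sets M. emeasure M (T -` B \<inter> space M) = emeasure M B)"

text \<open>The real logarithm satisfies \<open>ln 0 = 0\<close>, whereas the convention needed here is
  \<open>- log 0 = \<infinity>\<close>.\<close>

definition neg_log :: "real \<Rightarrow> ereal" where
  "neg_log p = (if p = 0 then \<infinity> else ereal (- ln p))"

definition restricted_pairwise_sensitive ::
  "'a measure \<Rightarrow> ('a \<Rightarrow> 'a \<Rightarrow> real) \<Rightarrow> ('a \<Rightarrow> 'a) \<Rightarrow> real \<Rightarrow> real \<Rightarrow> bool" where
  "restricted_pairwise_sensitive M d T \<delta> a \<longleftrightarrow>
     (AE (x, y) in M \<Otimes>\<^sub>M M.
        \<exists>n::nat. ereal (real n) \<le> ereal a * neg_log (measure M (open_ball M d x (d x y))) \<and>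
                 d ((T ^^ n) x) ((T ^^ n) y) > \<delta>)"

text \<open>The supremum is taken in \<^typ>\<open>ennreal\<close>, so that an unbounded set has diameter
  \<open>\<infinity>\<close>.\<close>

definition diam :: "('a \<Rightarrow> 'a \<Rightarrow> real) \<Rightarrow> 'a set \<Rightarrow> ennreal" where
  "diam d A = (SUP x\<in>A. SUP y\<in>A. ennreal (d x y))"

definition finite_measurable_partition :: "'a measure \<Rightarrow> 'a set set \<Rightarrow> bool" where
  "finite_measurable_partition M P \<longleftrightarrow> finite P \<and> P \<subseteq> sets M \<and> partition_on (space M) P"

definition preimage_partition :: "'a measure \<Rightarrow> ('a \<Rightarrow> 'a) \<Rightarrow> 'a set set \<Rightarrow> 'a set set" where
  "preimage_partition M f P = (\<lambda>A. f -` A \<inter> space M) ` P - {{}}"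

text \<open>The join of \<open>P, T\<^sup>-\<^sup>1 P, \<dots>, T\<^sup>-\<^sup>(\<^sup>n\<^sup>-\<^sup>1\<^sup>) P\<close>.\<close>

definition iterated_join :: "'a measure \<Rightarrow> ('a \<Rightarrow> 'a) \<Rightarrow> 'a set set \<Rightarrow> nat \<Rightarrow> 'a set set" where
  "iterated_join M T P n = common_refinement ((\<lambda>i. preimage_partition M (T ^^ i) P) ` {..<n})"

definition partition_entropy :: "'a measure \<Rightarrow> 'a set set \<Rightarrow> real" where
  "partition_entropy M P = - (\<Sum>A\<in>P. measure M A * ln (measure M A))"

text \<open>For measure-preserving \<open>T\<close> and a finite measurable partition the limit exists, by
  subadditivity of \<open>n \<mapsto> partition_entropy M (iterated_join M T P n)\<close>. The value at
  \<open>n = 0\<close> is irrelevant.\<close>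

definition metric_entropy :: "'a measure \<Rightarrow> ('a \<Rightarrow> 'a) \<Rightarrow> 'a set set \<Rightarrow> real" where
  "metric_entropy M T P = lim (\<lambda>n. partition_entropy M (iterated_join M T P n) / real n)"

end

theory Submission
  imports Defs
begin

text \<open>
  Write \<open>P_n(x)\<close> for the atom containing \<open>x\<close> of the join of the first \<open>n\<close> preimages of the
  partition, and \<open>I_n(x) = - ln \<mu>(P_n(x))\<close> for its information, so that the entropy of the join is
  \<open>H_n = \<integral> I_n d\<mu>\<close>. The theorem is a pointwise statement about \<open>I_n\<close>, integrated.

  Fix a typical point \<open>x\<close>. If \<open>y \<in> P_n(x)\<close>, then the orbits of \<open>x\<close> and \<open>y\<close> lie in a common cell,
  of diameter less than \<open>\<delta>\<close>, at all times below \<open>n\<close>; so they can only be separated by more than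
  \<open>\<delta>\<close> at some time \<open>k \<ge> n\<close>. Sensitivity provides such a \<open>k\<close> with
  \<open>k \<le> - a ln \<mu>(B)\<close>, where \<open>B\<close> is the open ball about \<open>x\<close> whose radius is the distance to \<open>y\<close>.
  Hence \<open>\<mu>(B) \<le> e^(-n/a)\<close>. All points \<open>y\<close> with this property lie in one closed ball about \<open>x\<close>,
  and by regularity of the metric that ball has measure at most \<open>e^(-n/a) / c\<close>, where \<open>c\<close>
  depends on \<open>x\<close> alone (lemma \<open>measure_small_ball_points_le\<close>). So
  \<open>I_n(x) \<ge> n/a + ln c\<close> (lemma \<open>AE_itinerary_fibre_le\<close>), and \<open>liminf I_n(x)/n \<ge> 1/a\<close>
  almost everywhere. Although \<open>c\<close> has no uniform lower bound, Fatou's lemma gives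
  \<open>liminf H_n/n \<ge> 1/a\<close>.

  Since the metric entropy is defined by the operator \<open>lim\<close>, convergence of \<open>H_n/n\<close> has to be
  established as well. It follows by Fekete's argument (lemma \<open>subadditive_imp_convergent\<close>) from
  \<open>H_(m+n) \<le> H_m + H_n\<close>. To obtain this inequality, the join is described as
  the partition into fibres of the random variable that sends a point to its itinerary, the list
  of cells it visits (lemma \<open>iterated_join_eq_fibres\<close>): an itinerary of length \<open>m + n\<close> is an
  itinerary of length \<open>m\<close> followed by one of length \<open>n\<close> seen from time \<open>m\<close>, and entropy
  is subadditive on pairs of random variables and invariant under \<open>T\<close>.
\<close>

section \<open>Subadditive sequences\<close>

text \<open>Fekete's lemma: dividing \<open>n\<close> by a fixed \<open>m\<close> with remainder gives
  \<open>u n \<le> (n div m) * u m + O(1)\<close>, so \<open>u n / n\<close> is eventually below any number above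
  \<open>u m / m\<close>, while it is never below the infimum of all these quotients.\<close>

lemma subadditive_imp_convergent:
  fixes u :: "nat \<Rightarrow> real"
  assumes sub: "\<And>m n. u (m + n) \<le> u m + u n" and nonneg: "\<And>n. 0 \<le> u n"
  shows "convergent (\<lambda>n. u n / real n)"
proof -
  define L where "L = (INF n\<in>{1..}. u n / real n)"
  have bdd: "bdd_below ((\<lambda>n. u n / real n) ` {1..})"
    by (rule bdd_belowI[of _ 0]) (use nonneg in auto)
  have mult: "u (q * m + r) \<le> real q * u m + u r" for q m r
  proof (induction q)
    case (Suc q)
    have "u (Suc q * m + r) = u (m + (q * m + r))" by (simp add: algebra_simps)
    also have "\<dots> \<le> u m + u (q * m + r)" by (rule sub)
    also have "\<dots> \<le> real (Suc q) * u m + u r" using Suc by (simp add: algebra_simps)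
    finally show ?case .
  qed simp
  have "(\<lambda>n. u n / real n) \<longlonglongrightarrow> L"
  proof (rule LIMSEQ_I)
    fix e :: real assume e: "0 < e"
    obtain m where m: "1 \<le> m" "u m / real m < L + e / 2"
    proof -
      have "\<exists>y\<in>(\<lambda>n. u n / real n) ` {1..}. y < L + e / 2"
        unfolding L_def using e by (subst cInf_less_iff[symmetric]) (use bdd in auto)
      then show ?thesis using that by auto
    qed
    define C where "C = Max (u ` {..<m})"
    have C: "u r \<le> C" if "r < m" for r unfolding C_def using that by (intro Max_ge) auto
    have "C \<ge> 0" using C[of 0] nonneg[of 0] m by linarith
    obtain N :: nat where N: "real N > 2 * C / e" using reals_Archimedean2 by blast
    show "\<exists>no. \<forall>n\<ge>no. norm (u n / real n - L) < e"
    proof (intro exI[of _ "max 1 N"] allI impI)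
      fix n assume n: "max 1 N \<le> n"
      then have np: "real n > 0" by simp
      have lower: "L \<le> u n / real n"
        unfolding L_def by (rule cINF_lower[OF bdd]) (use n in auto)
      have "u n \<le> real (n div m) * u m + u (n mod m)"
        using mult[of "n div m" m "n mod m"] by simp
      also have "\<dots> \<le> real n / real m * u m + C"
      proof (intro add_mono mult_right_mono)
        show "real (n div m) \<le> real n / real m" by (rule of_nat_div_le_of_nat)
      qed (use C m nonneg in auto)
      finally have "u n / real n \<le> u m / real m + C / real n"
        using np m by (simp add: field_simps)
      moreover have "C / real n < e / 2"
      proof -
        have "2 * C / e < real n" using N n by linarith
        then show ?thesis using e np by (simp add: field_simps)
      qed
      ultimately have "u n / real n - L < e" using m(2) by linarith
      then show "norm (u n / real n - L) < e" using lower by simp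
    qed
  qed
  then show ?thesis by (rule convergentI)
qed

section \<open>Points whose distance ball is small\<close>

text \<open>The open balls about \<open>x\<close> of measure at most \<open>e\<close> have bounded radii, as the balls exhaust a
  space of measure \<open>1 > e\<close>. By continuity from below the supremum \<open>R\<close> of these radii is
  attained, so all points in question lie in the closed ball of radius \<open>R\<close>, to which the regularity
  estimate applies. If \<open>R = 0\<close>, that estimate says nothing, but the closed ball is the
  null set \<open>{x}\<close>. The enclosing set \<open>S\<close> is that closed ball.\<close>

lemma measure_small_ball_points_le:
  assumes M: "prob_space M" and met: "Metric_space (space M) d" and x: "x \<in> space M"
    and sec: "(\<lambda>y. d x y) \<in> borel_measurable M"
    and null: "measure M {x} = 0"
    and c: "0 < c" "\<And>r. 0 < r \<Longrightarrow> c * measure M (closed_ball M d x r) \<le> measure M (open_ball M d x r)"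
    and e: "0 \<le> e" "e < 1"
  shows "\<exists>S\<in>sets M. {y\<in>space M. measure M (open_ball M d x (d x y)) \<le> e} \<subseteq> S \<and> measure M S \<le> e / c"
proof -
  interpret prob_space M by fact
  interpret Metric_space "space M" d by fact
  have ball: "mball x r = {y\<in>space M. d x y < r}" for r using x by (auto simp: mball_def)
  have cball: "mcball x r = {y\<in>space M. d x y \<le> r}" for r using x by (auto simp: mcball_def)
  have [measurable]: "(\<lambda>y. d x y) \<in> borel_measurable M" by (rule sec)
  have ball_sets: "mball x r \<in> sets M" and cball_sets: "mcball x r \<in> sets M" for r
    unfolding ball cball by measurable
  have tend: "(\<lambda>n. prob (mball x (f n))) \<longlonglongrightarrow> prob (\<Union>n. mball x (f n))" if "incseq f" for f
    by (rule finite_Lim_measure_incseq)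
      (use ball_sets that in \<open>auto simp: incseq_def ball intro: less_le_trans\<close>)
  define E where "E = {r. prob (mball x r) \<le> e}"
  have down: "s \<in> E" if "r \<in> E" "s \<le> r" for r s
  proof -
    have "prob (mball x s) \<le> prob (mball x r)"
      using that by (intro finite_measure_mono ball_sets) (auto simp: ball)
    then show ?thesis using that by (simp add: E_def)
  qed
  have "mball x 0 = {}" by (auto simp: ball not_less)
  then have "0 \<in> E" using e by (simp add: E_def)
  have bdd: "bdd_above E"
  proof (rule ccontr)
    assume unb: "\<not> bdd_above E"
    have all: "r \<in> E" for r
      using unb down by (meson bdd_aboveI nle_le)
    have "(\<Union>n. mball x (real n)) = space M"
      using reals_Archimedean2 by (auto simp: ball)
    moreover have "incseq real" by (simp add: incseq_def)
    ultimately have "(\<lambda>n. prob (mball x (real n))) \<longlonglongrightarrow> 1"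
      using tend[of real] prob_space by simp
    then have "1 \<le> e" by (rule LIMSEQ_le_const2) (use all E_def in auto)
    with e show False by simp
  qed
  define R where "R = Sup E"
  have "0 \<le> R" unfolding R_def using \<open>0 \<in> E\<close> bdd by (rule cSup_upper)
  have RE: "R \<in> E"
  proof -
    \<comment> \<open>Radii strictly below the supremum belong to \<open>E\<close>, and their balls increase to the open ball
      of radius \<open>R\<close>.\<close>
    define f where "f n = R - 1 / real (Suc n)" for n
    have inc: "incseq f" unfolding f_def incseq_def
      by (auto intro!: divide_left_mono)
    have "(\<Union>n. mball x (f n)) = mball x R"
    proof (intro equalityI subsetI)
      fix y assume y: "y \<in> mball x R"
      then obtain n where "inverse (real (Suc n)) < R - d x y"
        using reals_Archimedean[of "R - d x y"] by (auto simp: ball)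
      then have "d x y < f n" by (simp add: f_def field_simps)
      then show "y \<in> (\<Union>n. mball x (f n))" using y by (auto simp: ball)
    next
      fix y assume "y \<in> (\<Union>n. mball x (f n))"
      then obtain n where y: "y \<in> space M" "d x y < f n" by (auto simp: ball)
      have "f n \<le> R" by (simp add: f_def)
      with y show "y \<in> mball x R" by (simp add: ball)
    qed
    then have "(\<lambda>n. prob (mball x (f n))) \<longlonglongrightarrow> prob (mball x R)"
      using tend[OF inc] by simp
    moreover have "f n \<in> E" for n
    proof -
      have "f n < Sup E" by (simp add: f_def R_def)
      then obtain r where "r \<in> E" "f n < r"
        using less_cSup_iff[of E "f n"] \<open>0 \<in> E\<close> bdd by auto
      then show ?thesis using down by simp
    qed
    ultimately show ?thesis
      unfolding E_def by (auto intro: LIMSEQ_le_const2)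
  qed
  have "{y\<in>space M. prob (mball x (d x y)) \<le> e} \<subseteq> mcball x R"
    using cSup_upper[OF _ bdd] by (auto simp: cball E_def R_def)
  moreover have "prob (mcball x R) \<le> e / c"
  proof (cases "R = 0")
    case True
    have "d x y \<le> 0 \<longleftrightarrow> y = x" if "y \<in> space M" for y
      using zero[OF x that] nonneg[of x y] by (metis order_antisym order_refl)
    then have "mcball x 0 = {x}" using x by (auto simp: cball)
    then show ?thesis using True null e c by simp
  next
    case False
    then have "c * prob (mcball x R) \<le> prob (mball x R)" using c \<open>0 \<le> R\<close> by simp
    also have "\<dots> \<le> e" using RE by (simp add: E_def)
    finally show ?thesis using c by (simp add: field_simps)
  qed
  ultimately show ?thesis using cball_sets by blast
qed

lemma nonatomic_singleton_null:
  assumes "prob_space M" "nonatomic M" "{x} \<in> sets M"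
  shows "measure M {x} = 0"
proof -
  interpret prob_space M by fact
  have "\<not> 0 < emeasure M {x}"
  proof
    assume "0 < emeasure M {x}"
    then obtain B where "B \<subseteq> {x}" "0 < emeasure M B" "emeasure M B < emeasure M {x}"
      using assms unfolding nonatomic_def by blast
    then show False by (cases "B = {}") (auto simp: subset_singleton_iff)
  qed
  then show ?thesis by (simp add: measure_def)
qed

section \<open>Itineraries and the iterated join\<close>

text \<open>Meaningful for points covered by a partition \<open>P\<close>, where exactly one such \<open>A\<close> exists.\<close>

definition cell :: "'a set set \<Rightarrow> 'a \<Rightarrow> 'a set" where
  "cell P x = (THE A. A \<in> P \<and> x \<in> A)"

definition itinerary :: "'a set set \<Rightarrow> ('a \<Rightarrow> 'a) \<Rightarrow> nat \<Rightarrow> 'a \<Rightarrow> 'a set list" where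
  "itinerary P T n x = map (\<lambda>i. cell P ((T ^^ i) x)) [0..<n]"

lemma cell_eqI:
  assumes "partition_on S P" "A \<in> P" "x \<in> A"
  shows "cell P x = A"
  unfolding cell_def using assms by (intro the_equality) (auto simp: partition_on_def disjoint_def)

lemma cell_in_partition:
  assumes "partition_on S P" "x \<in> S"
  shows "cell P x \<in> P" "x \<in> cell P x"
proof -
  obtain A where "A \<in> P" "x \<in> A" using assms by (auto simp: partition_on_def)
  then show "cell P x \<in> P" "x \<in> cell P x" using cell_eqI[OF assms(1)] by auto
qed

text \<open>The cocycle identity behind subadditivity of the entropy of the iterated joins.\<close>

lemma itinerary_add:
  "itinerary P T (m + n) x = itinerary P T m x @ itinerary P T n ((T ^^ m) x)"
proof (rule nth_equalityI)
  fix i assume i: "i < length (itinerary P T (m + n) x)"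
  show "itinerary P T (m + n) x ! i = (itinerary P T m x @ itinerary P T n ((T ^^ m) x)) ! i"
  proof (cases "i < m")
    case False
    then have "(T ^^ i) x = (T ^^ (i - m)) ((T ^^ m) x)"
      using funpow_add[of "i - m" m T] by simp
    with False i show ?thesis by (simp add: itinerary_def nth_append del: funpow.simps)
  qed (use i in \<open>simp add: itinerary_def nth_append\<close>)
qed (simp add: itinerary_def)

lemma itinerary_eq_iff:
  "itinerary P T n x = itinerary P T n y \<longleftrightarrow>
     (\<forall>i<n. cell P ((T ^^ i) x) = cell P ((T ^^ i) y))"
  by (auto simp: itinerary_def)

lemma measure_preserving_funpow:
  assumes "measure_preserving_map M T"
  shows "measure_preserving_map M (T ^^ n)"
proof (induction n)
  case 0
  have "B \<inter> space M = B" if "B \<in> sets M" for B using sets.sets_into_space[OF that] by auto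
  then show ?case by (auto simp: measure_preserving_map_def)
next
  case (Suc n)
  have [measurable]: "T \<in> measurable M M" "T ^^ n \<in> measurable M M"
    using assms Suc by (auto simp: measure_preserving_map_def)
  have "emeasure M ((T ^^ Suc n) -` B \<inter> space M) = emeasure M B" if [measurable]: "B \<in> sets M" for B
  proof -
    have "(T ^^ Suc n) -` B \<inter> space M = (T ^^ n) -` (T -` B \<inter> space M) \<inter> space M"
      using measurable_space[of "T ^^ n" M M] by auto
    moreover have "T -` B \<inter> space M \<in> sets M" by measurable
    ultimately show ?thesis
      using assms Suc that unfolding measure_preserving_map_def by metis
  qed
  moreover have "T ^^ Suc n \<in> measurable M M" by simp
  ultimately show ?case unfolding measure_preserving_map_def by blast
qed

lemma funpow_in_space:
  assumes "measure_preserving_map M T" "x \<in> space M"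
  shows "(T ^^ n) x \<in> space M"
proof -
  have "T ^^ n \<in> measurable M M"
    using measure_preserving_funpow[OF assms(1)] unfolding measure_preserving_map_def by blast
  from measurable_space[OF this assms(2)] show ?thesis .
qed

lemma simple_function_cell:
  assumes P: "finite_measurable_partition M P"
  shows "simple_function M (cell P)"
proof -
  have part: "partition_on (space M) P" and fin: "finite P" and sets: "P \<subseteq> sets M"
    using P by (auto simp: finite_measurable_partition_def)
  have sub: "cell P ` space M \<subseteq> P" using cell_in_partition[OF part] by auto
  then have "finite (cell P ` space M)" using fin by (rule finite_subset)
  moreover have "cell P -` {A} \<inter> space M = A" if "A \<in> P" for A
    using cell_in_partition[OF part] cell_eqI[OF part] that part
    by (auto simp: partition_on_def)
  ultimately show ?thesis
    using sub sets by (auto simp: simple_function_def subset_eq)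
qed

lemma simple_function_itinerary:
  assumes "measure_preserving_map M T" "finite_measurable_partition M P"
  shows "simple_function M (itinerary P T n)"
proof (induction n)
  case 0
  have "itinerary P T 0 = (\<lambda>_. [])" by (simp add: itinerary_def fun_eq_iff)
  then show ?case by simp
next
  case (Suc n)
  have "T ^^ n \<in> measurable M M"
    using measure_preserving_funpow[OF assms(1), of n] by (simp add: measure_preserving_map_def)
  then have "simple_function M (\<lambda>x. cell P ((T ^^ n) x))"
    using simple_function_cell[OF assms(2)] by (rule simple_function_comp)
  then have "simple_function M (\<lambda>x. itinerary P T n x @ [cell P ((T ^^ n) x)])"
    by (rule simple_function_compose2[OF Suc, where h = "\<lambda>u A. u @ [A]"])
  then show ?case by (simp add: itinerary_def)
qed

text \<open>Indexing the blocks by their points, rather than by the cells of \<open>P\<close>, discards empty preimages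
  automatically.\<close>

lemma preimage_partition_eq_fibres:
  assumes part: "partition_on (space M) P" and S: "\<And>x. x \<in> space M \<Longrightarrow> S x \<in> space M"
  shows "preimage_partition M S P = (\<lambda>x. {y\<in>space M. cell P (S y) = cell P (S x)}) ` space M"
proof -
  have eq: "S -` A \<inter> space M = {y\<in>space M. cell P (S y) = cell P (S x)}"
    if "A \<in> P" "x \<in> space M" "S x \<in> A" for A x
  proof (intro equalityI subsetI)
    fix y assume "y \<in> S -` A \<inter> space M"
    then show "y \<in> {y\<in>space M. cell P (S y) = cell P (S x)}"
      using cell_eqI[OF part that(1)] that by simp
  next
    fix y assume "y \<in> {y\<in>space M. cell P (S y) = cell P (S x)}"
    then have "y \<in> space M" "cell P (S y) = A" using cell_eqI[OF part that(1,3)] by auto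
    then show "y \<in> S -` A \<inter> space M" using cell_in_partition(2)[OF part S, of y] by auto
  qed
  show ?thesis
  proof (intro equalityI subsetI)
    fix B assume "B \<in> preimage_partition M S P"
    then obtain A x where "A \<in> P" "B = S -` A \<inter> space M" "x \<in> B"
      by (auto simp: preimage_partition_def)
    then show "B \<in> (\<lambda>x. {y\<in>space M. cell P (S y) = cell P (S x)}) ` space M"
      using eq by auto
  next
    fix B assume "B \<in> (\<lambda>x. {y\<in>space M. cell P (S y) = cell P (S x)}) ` space M"
    then obtain x where x: "x \<in> space M" "B = {y\<in>space M. cell P (S y) = cell P (S x)}" by auto
    then have "B = S -` cell P (S x) \<inter> space M" "x \<in> B" "cell P (S x) \<in> P"
      using eq cell_in_partition[OF part] S by auto
    then show "B \<in> preimage_partition M S P" by (auto simp: preimage_partition_def)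
  qed
qed

text \<open>A block of the common refinement is an intersection of one block from each preimage partition;
  any point of the block determines these choices, since it lies in only one block of each. The
  case \<open>n = 0\<close> is excluded because the common refinement of the empty family is \<open>{UNIV}\<close>, whereas
  the fibre of the empty itinerary is \<open>space M\<close>.\<close>

lemma iterated_join_eq_fibres:
  assumes T: "measure_preserving_map M T" and part: "partition_on (space M) P" and n: "0 < n"
  shows "iterated_join M T P n =
    (\<lambda>x. {y\<in>space M. itinerary P T n y = itinerary P T n x}) ` space M"
proof -
  define g where "g i x = {y\<in>space M. cell P ((T ^^ i) y) = cell P ((T ^^ i) x)}" for i x
  define Q where "Q = (\<lambda>i. preimage_partition M (T ^^ i) P) ` {..<n}"
  have Qi: "preimage_partition M (T ^^ i) P = g i ` space M" for i
    unfolding g_def by (rule preimage_partition_eq_fibres[OF part]) (rule funpow_in_space[OF T])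
  have fibre: "{y\<in>space M. itinerary P T n y = itinerary P T n x} = (\<Inter>i<n. g i x)" for x
    using n by (auto simp: itinerary_eq_iff g_def)
  have memb: "x \<in> space M \<and> X = (\<Inter>i<n. g i x)" if X: "X \<in> common_refinement Q" "x \<in> X" for X x
  proof -
    obtain f where f: "\<And>R. R \<in> Q \<Longrightarrow> f R \<in> R" and Xf: "X = \<Inter> (f ` Q)"
      using X by (auto simp: common_refinement Pi_iff)
    have fg: "f (preimage_partition M (T ^^ i) P) = g i x \<and> x \<in> space M" if "i < n" for i
    proof -
      let ?R = "preimage_partition M (T ^^ i) P"
      have "?R \<in> Q" using that by (auto simp: Q_def)
      then have "f ?R \<in> g i ` space M" "x \<in> f ?R" using f X Xf Qi by auto
      then show ?thesis by (auto simp: g_def)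
    qed
    then show ?thesis using n Xf by (auto simp: Q_def)
  qed
  have "\<Union> (common_refinement Q) = (\<Inter>i<n. \<Union> (g i ` space M))"
    by (simp add: Union_common_refinement Q_def Qi)
  also have "\<dots> = space M" using n by (auto simp: g_def)
  finally have un: "\<Union> (common_refinement Q) = space M" .
  have "common_refinement Q = (\<lambda>x. \<Inter>i<n. g i x) ` space M"
  proof (intro equalityI subsetI)
    fix X assume X: "X \<in> common_refinement Q"
    then have "X \<noteq> {}" by (simp add: common_refinement_def)
    then obtain x where "x \<in> X" by auto
    then show "X \<in> (\<lambda>x. \<Inter>i<n. g i x) ` space M" using memb[OF X] by blast
  next
    fix X assume "X \<in> (\<lambda>x. \<Inter>i<n. g i x) ` space M"
    then obtain x where x: "x \<in> space M" "X = (\<Inter>i<n. g i x)" by auto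
    then obtain Y where "Y \<in> common_refinement Q" "x \<in> Y" using un by blast
    then show "X \<in> common_refinement Q" using memb x by blast
  qed
  then show ?thesis unfolding fibre by (simp add: iterated_join_def Q_def)
qed

section \<open>Entropy of random variables with finitely many values\<close>

text \<open>Natural logarithms, in agreement with \<open>partition_entropy\<close>: this is the entropy to base
  \<open>exp 1\<close> in the sense of \<open>information_space\<close>.\<close>

definition shannon_entropy :: "'a measure \<Rightarrow> ('a \<Rightarrow> 'b) \<Rightarrow> real" where
  "shannon_entropy M X =
    - (\<Sum>v\<in>X ` space M. measure M (X -` {v} \<inter> space M) * ln (measure M (X -` {v} \<inter> space M)))"

lemma (in information_space) entropy_eq_shannon_entropy:
  assumes "b = exp 1" "simple_function M X"
  shows "\<H>(X) = shannon_entropy M X"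
  by (subst entropy_simple_distributed[OF simple_distributedI[OF assms(2) measure_nonneg refl]])
    (simp add: assms(1) log_def shannon_entropy_def)

text \<open>A function of the pair \<open>(X, Y)\<close> carries no more entropy than the pair, and by the chain rule
  the pair adds to \<open>X\<close> only the conditional entropy of \<open>Y\<close>, which conditioning can only lower.\<close>

lemma (in information_space) shannon_entropy_combine_le_base_exp:
  assumes b: "b = exp 1" and X: "simple_function M X" and Y: "simple_function M Y"
  shows "shannon_entropy M (\<lambda>x. f (X x) (Y x)) \<le> shannon_entropy M X + shannon_entropy M Y"
proof -
  have XY: "simple_function M (\<lambda>x. f (X x) (Y x))"
    using X Y by (rule simple_function_compose2)
  have "\<H>(case_prod f \<circ> (\<lambda>x. (X x, Y x))) \<le> \<H>(\<lambda>x. (X x, Y x))"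
    by (rule entropy_data_processing[OF simple_function_Pair[OF X Y]])
  also have "\<dots> = \<H>(X) + \<H>(Y | X)" by (rule entropy_chain_rule[OF X Y])
  also have "\<H>(Y | X) \<le> \<H>(Y)" by (rule conditional_entropy_less_eq_entropy[OF Y X])
  finally have "\<H>(\<lambda>x. f (X x) (Y x)) \<le> \<H>(X) + \<H>(Y)" by (simp add: comp_def)
  then show ?thesis
    by (simp only: entropy_eq_shannon_entropy[OF b X] entropy_eq_shannon_entropy[OF b Y] entropy_eq_shannon_entropy[OF b XY])
qed

lemma partition_entropy_fibres:
  shows "partition_entropy M ((\<lambda>x. {y\<in>space M. X y = X x}) ` space M) =
    shannon_entropy M X"
proof -
  have im: "(\<lambda>x. {y\<in>space M. X y = X x}) ` space M = (\<lambda>v. X -` {v} \<inter> space M) ` X ` space M"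
    unfolding image_image by (intro image_cong) auto
  have inj: "inj_on (\<lambda>v. X -` {v} \<inter> space M) (X ` space M)"
    by (intro inj_onI) blast
  show ?thesis by (simp add: partition_entropy_def shannon_entropy_def im sum.reindex[OF inj])
qed

text \<open>Entropy as expected information; the nonnegative integral is the form to which Fatou's lemma
  applies.\<close>

lemma shannon_entropy_eq_nn_integral:
  assumes M: "prob_space M" and X: "simple_function M X"
  shows "0 \<le> shannon_entropy M X"
    and "ennreal (shannon_entropy M X) =
      (\<integral>\<^sup>+x. ennreal (- ln (measure M {y\<in>space M. X y = X x})) \<partial>M)"
proof -
  interpret prob_space M by fact
  let ?F = "\<lambda>v. X -` {v} \<inter> space M"
  let ?p = "\<lambda>v. prob (?F v)"
  have [measurable]: "?F v \<in> sets M" for v using X by (rule simple_functionD)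
  have fin: "finite (X ` space M)" using X by (rule simple_functionD)
  have ln_nn: "0 \<le> - ln (?p v)" for v by (cases "?p v = 0") (auto simp: less_le)
  have H: "shannon_entropy M X = (\<Sum>v\<in>X ` space M. - ln (?p v) * ?p v)"
    by (simp add: shannon_entropy_def sum_negf mult.commute)
  show "0 \<le> shannon_entropy M X"
    unfolding H by (intro sum_nonneg mult_nonneg_nonneg ln_nn measure_nonneg)
  have "(\<integral>\<^sup>+x. ennreal (- ln (measure M {y\<in>space M. X y = X x})) \<partial>M) =
      (\<integral>\<^sup>+x. (\<Sum>v\<in>X ` space M. ennreal (- ln (?p v)) * indicator (?F v) x) \<partial>M)"
  proof (rule nn_integral_cong)
    fix x assume x: "x \<in> space M"
    have "(\<Sum>v\<in>X ` space M. ennreal (- ln (?p v)) * indicator (?F v) x) =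
        (\<Sum>v\<in>X ` space M. if v = X x then ennreal (- ln (?p (X x))) else 0)"
      using x by (intro sum.cong) (auto simp: indicator_def)
    also have "\<dots> = ennreal (- ln (?p (X x)))" using fin x by simp
    also have "?F (X x) = {y\<in>space M. X y = X x}" by auto
    finally show "ennreal (- ln (measure M {y\<in>space M. X y = X x})) =
        (\<Sum>v\<in>X ` space M. ennreal (- ln (?p v)) * indicator (?F v) x)" by simp
  qed
  also have "\<dots> = (\<Sum>v\<in>X ` space M. ennreal (- ln (?p v)) * emeasure M (?F v))"
    by (simp add: nn_integral_sum nn_integral_cmult_indicator)
  also have "\<dots> = (\<Sum>v\<in>X ` space M. ennreal (- ln (?p v) * ?p v))"
    by (intro sum.cong refl) (simp only: emeasure_eq_measure ennreal_mult[OF ln_nn measure_nonneg])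
  also have "\<dots> = ennreal (shannon_entropy M X)"
    unfolding H by (intro sum_ennreal mult_nonneg_nonneg ln_nn measure_nonneg)
  finally show "ennreal (shannon_entropy M X) =
      (\<integral>\<^sup>+x. ennreal (- ln (measure M {y\<in>space M. X y = X x})) \<partial>M)" by simp
qed

text \<open>\<open>X \<circ> S\<close> has the same distribution as \<open>X\<close>. It may miss some values of \<open>X\<close>, but these have
  probability zero and contribute nothing to the sum.\<close>

lemma shannon_entropy_comp_measure_preserving:
  assumes M: "prob_space M" and X: "simple_function M X" and S: "measure_preserving_map M S"
  shows "shannon_entropy M (\<lambda>x. X (S x)) =
    shannon_entropy M X"
proof -
  interpret prob_space M by fact
  have Sm: "S \<in> measurable M M" using S by (simp add: measure_preserving_map_def)
  let ?F = "\<lambda>v. X -` {v} \<inter> space M" and ?G = "\<lambda>v. (\<lambda>x. X (S x)) -` {v} \<inter> space M"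
  have G: "?G v = S -` ?F v \<inter> space M" for v using measurable_space[OF Sm] by auto
  have "?F v \<in> sets M" for v using X by (rule simple_functionD)
  then have eq: "prob (?G v) = prob (?F v)" for v
    using S unfolding G measure_preserving_map_def measure_def by metis
  have sub: "(\<lambda>x. X (S x)) ` space M \<subseteq> X ` space M" using measurable_space[OF Sm] by auto
  have zero: "prob (?F v) = 0" if "v \<notin> (\<lambda>x. X (S x)) ` space M" for v
  proof -
    have "?G v = {}" using that by auto
    then show ?thesis using eq[of v] by simp
  qed
  have "(\<Sum>v\<in>(\<lambda>x. X (S x)) ` space M. prob (?F v) * ln (prob (?F v))) =
      (\<Sum>v\<in>X ` space M. prob (?F v) * ln (prob (?F v)))"
    using zero by (intro sum.mono_neutral_left sub simple_functionD(1)[OF X]) auto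
  then show ?thesis
    by (simp add: shannon_entropy_def eq)
qed

lemma shannon_entropy_combine_le:
  fixes f :: "'b \<Rightarrow> 'c \<Rightarrow> 'd"
  assumes M: "prob_space M" and X: "simple_function M X" and Y: "simple_function M Y"
  shows "shannon_entropy M (\<lambda>x. f (X x) (Y x)) \<le> shannon_entropy M X + shannon_entropy M Y"
proof -
  have inf: "information_space M (exp 1)"
    using M by (simp add: information_space_def information_space_axioms_def)
  show ?thesis using information_space.shannon_entropy_combine_le_base_exp[OF inf refl X Y] .
qed

lemma shannon_entropy_itinerary_add_le:
  assumes M: "prob_space M" and T: "measure_preserving_map M T"
    and P: "finite_measurable_partition M P"
  shows "shannon_entropy M (itinerary P T (m + n)) \<le>
    shannon_entropy M (itinerary P T m) + shannon_entropy M (itinerary P T n)"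
proof -
  let ?X = "itinerary P T m" and ?Y = "\<lambda>x. itinerary P T n ((T ^^ m) x)"
  note sf = simple_function_itinerary[OF T P]
  note Tm = measure_preserving_funpow[OF T, of m]
  have Y: "simple_function M ?Y"
    using Tm sf unfolding measure_preserving_map_def by (blast intro: simple_function_comp)
  have "shannon_entropy M (itinerary P T (m + n)) = shannon_entropy M (\<lambda>x. ?X x @ ?Y x)"
    by (simp only: itinerary_add[abs_def])
  also have "\<dots> \<le> shannon_entropy M ?X + shannon_entropy M ?Y"
    by (rule shannon_entropy_combine_le[OF M sf Y])
  also have "shannon_entropy M ?Y = shannon_entropy M (itinerary P T n)"
    by (rule shannon_entropy_comp_measure_preserving[OF M sf Tm])
  finally show ?thesis .
qed

section \<open>The lower bound\<close>

text \<open>There are finitely many fibres, so those of measure zero have a null union. This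
  excludes the points at which \<open>ln 0 = 0\<close> would spoil the lower bound on the information.\<close>

lemma AE_simple_function_fibre_pos:
  assumes X: "simple_function M X" and M: "prob_space M"
  shows "AE x in M. 0 < measure M {y\<in>space M. X y = X x}"
proof -
  interpret prob_space M by fact
  let ?F = "\<lambda>v. X -` {v} \<inter> space M"
  have sets: "?F v \<in> sets M" for v using X by (rule simple_functionD)
  have "AE x in M. \<forall>v\<in>X ` space M. x \<in> ?F v \<longrightarrow> 0 < prob (?F v)"
  proof (rule AE_finite_allI)
    show "finite (X ` space M)" using X by (rule simple_functionD)
    fix v
    show "AE x in M. x \<in> ?F v \<longrightarrow> 0 < prob (?F v)"
    proof (cases "prob (?F v) = 0")
      case True
      then have "?F v \<in> null_sets M" using sets by (auto simp: emeasure_eq_measure)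
      then have "AE x in M. x \<notin> ?F v" by (rule AE_not_in)
      then show ?thesis by (rule eventually_mono) blast
    qed (simp add: less_le)
  qed
  then show ?thesis
  proof (rule AE_mp, intro AE_I2 impI)
    fix x assume x: "x \<in> space M" and "\<forall>v\<in>X ` space M. x \<in> ?F v \<longrightarrow> 0 < prob (?F v)"
    then have "0 < prob (?F (X x))" by auto
    also have "?F (X x) = {y\<in>space M. X y = X x}" by auto
    finally show "0 < prob {y\<in>space M. X y = X x}" .
  qed
qed

text \<open>Points sharing the itinerary of \<open>x\<close> up to time \<open>n\<close> are not separated before time \<open>n\<close>, so by
  sensitivity almost all of them are so near to \<open>x\<close> that their distance ball has measure
  at most \<open>e^(-n/a)\<close>. The constant \<open>c\<close> is the one of regularity at \<open>x\<close>, the same for all \<open>n\<close>.\<close>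

lemma AE_itinerary_fibre_le:
  fixes M :: "'a measure" and d :: "'a \<Rightarrow> 'a \<Rightarrow> real" and T :: "'a \<Rightarrow> 'a"
    and \<delta> a :: real and P :: "'a set set"
  assumes M: "prob_space M" and na: "nonatomic M"
    and met: "measurable_metric M d" and reg: "regular_metric M d"
    and T: "measure_preserving_map M T" and a: "a > 0"
    and sens: "restricted_pairwise_sensitive M d T \<delta> a"
    and P: "finite_measurable_partition M P" and diam: "\<And>A. A \<in> P \<Longrightarrow> diam d A < ennreal \<delta>"
  shows "AE x in M. \<exists>c>0. \<forall>n>0.
    measure M {y\<in>space M. itinerary P T n y = itinerary P T n x} \<le> exp (- (real n / a)) / c"
proof -
  interpret prob_space M by fact
  interpret P: pair_prob_space M M ..
  have part: "partition_on (space M) P" using P by (simp add: finite_measurable_partition_def)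
  let ?p = "\<lambda>x y. measure M (open_ball M d x (d x y))"
  let ?Q = "\<lambda>(x, y). \<exists>n::nat. ereal (real n) \<le> ereal a * neg_log (?p x y) \<and>
                 d ((T ^^ n) x) ((T ^^ n) y) > \<delta>"
  have "AE x in M. AE y in M. ?Q (x, y)"
    using sens unfolding restricted_pairwise_sensitive_def by (rule P.AE_pair)
  then show ?thesis
  proof (rule AE_mp, intro AE_I2 impI)
    fix x assume x: "x \<in> space M" and ae: "AE y in M. ?Q (x, y)"
    have M_met: "Metric_space (space M) d" and dm: "(\<lambda>(x, y). d x y) \<in> borel_measurable (M \<Otimes>\<^sub>M M)"
      using met by (auto simp: measurable_metric_def)
    interpret Metric_space "space M" d by (rule M_met)
    have sec [measurable]: "(\<lambda>y. d x y) \<in> borel_measurable M"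
      using measurable_compose_Pair1[OF x dm] by simp
    have "{y\<in>space M. d x y \<le> 0} \<in> sets M" by measurable
    moreover have "d x y \<le> 0 \<longleftrightarrow> y = x" if "y \<in> space M" for y
      using zero[OF x that] nonneg[of x y] by (metis order_antisym order_refl)
    then have "{y\<in>space M. d x y \<le> 0} = {x}" using x by auto
    ultimately have null: "prob {x} = 0" using nonatomic_singleton_null[OF M na] by simp
    obtain c where c: "0 < c" "\<And>r. 0 < r \<Longrightarrow> c * prob (mcball x r) \<le> prob (mball x r)"
      using reg x unfolding regular_metric_def by blast
    show "\<exists>c>0. \<forall>n>0. prob {y\<in>space M. itinerary P T n y = itinerary P T n x} \<le> exp (- (real n / a)) / c"
    proof (intro exI[of _ c] conjI allI impI c(1))
      fix n :: nat assume n: "0 < n"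
      let ?e = "exp (- (real n / a))" and ?I = "{y\<in>space M. itinerary P T n y = itinerary P T n x}"
      have "?e < 1" using n a by simp
      then obtain S where S: "S \<in> sets M" "{y\<in>space M. ?p x y \<le> ?e} \<subseteq> S" "prob S \<le> ?e / c"
        using measure_small_ball_points_le[OF M M_met x sec null c, of ?e] by auto
      have "AE y in M. y \<in> ?I \<longrightarrow> y \<in> S"
        using ae
      proof (rule AE_mp, intro AE_I2 impI)
        fix y assume y: "y \<in> ?I" and "?Q (x, y)"
        then obtain k :: nat where k: "ereal (real k) \<le> ereal a * neg_log (?p x y)"
          "\<delta> < d ((T ^^ k) x) ((T ^^ k) y)" by auto
        have "n \<le> k"
        proof (rule ccontr)
          assume "\<not> n \<le> k"
          let ?x = "(T ^^ k) x" and ?y = "(T ^^ k) y"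
          have "?x \<in> space M" "?y \<in> space M" using funpow_in_space[OF T] x y by auto
          moreover have "cell P ?x = cell P ?y"
            using y \<open>\<not> n \<le> k\<close> by (auto simp: itinerary_eq_iff)
          ultimately have A: "cell P ?x \<in> P" "?x \<in> cell P ?x" "?y \<in> cell P ?x"
            using cell_in_partition[OF part] by auto
          have "ennreal (d ?x ?y) \<le> diam d (cell P ?x)"
            unfolding diam_def using A by (intro SUP_upper2[of ?x] SUP_upper2[of ?y]) auto
          also have "\<dots> < ennreal \<delta>" using A by (intro diam)
          finally show False using k(2) by (simp add: ennreal_less_iff)
        qed
        have "?p x y \<le> ?e"
        proof (cases "?p x y = 0")
          case False
          then have pos: "0 < ?p x y" by (simp add: less_le)
          have "real k \<le> a * - ln (?p x y)" using k(1) False by (simp add: neg_log_def)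
          then have "real n \<le> a * - ln (?p x y)" using \<open>n \<le> k\<close> by linarith
          then have "ln (?p x y) \<le> - (real n / a)" using a by (simp add: field_simps)
          then show ?thesis using pos by (metis exp_le_cancel_iff exp_ln)
        qed simp
        then show "y \<in> S" using S y by auto
      qed
      then have "prob ?I \<le> prob S" using S by (intro finite_measure_mono_AE)
      with S show "prob ?I \<le> ?e / c" by linarith
    qed
  qed
qed

theorem theorem3p1:
  fixes M :: "'a measure" and d :: "'a \<Rightarrow> 'a \<Rightarrow> real" and T :: "'a \<Rightarrow> 'a"
    and \<delta> a :: real and P :: "'a set set"
  assumes "standard_prob_space M" and "nonatomic M"
    and "measurable_metric M d" and "compatible_metric M d" and "regular_metric M d"
    and "measure_preserving_map M T"
    and "\<delta> > 0" and "a > 0" and "restricted_pairwise_sensitive M d T \<delta> a"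
    and "finite_measurable_partition M P" and "\<And>A. A \<in> P \<Longrightarrow> diam d A < ennreal \<delta>"
  shows "metric_entropy M T P \<ge> 1 / a"
proof -
  have M: "prob_space M" using assms(1) by (simp add: standard_prob_space_def)
  interpret prob_space M by (rule M)
  note T = assms(6) and P = assms(10)
  let ?N = "itinerary P T"
  define H where "H n = shannon_entropy M (?N n)" for n
  define p where "p n x = prob {y\<in>space M. ?N n y = ?N n x}" for n x
  note sf = simple_function_itinerary[OF T P]
  have p_sf: "simple_function M (\<lambda>x. ennreal (g (p n x)))" for g n
    unfolding p_def by (rule simple_function_compose1[OF sf,
      where g = "\<lambda>v. ennreal (g (prob {y\<in>space M. ?N n y = v}))"])
  have H: "0 \<le> H n" "ennreal (H n) = (\<integral>\<^sup>+x. ennreal (- ln (p n x)) \<partial>M)" for n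
    unfolding H_def p_def by (rule shannon_entropy_eq_nn_integral[OF M sf])+
  have "convergent (\<lambda>n. H n / real n)"
    using shannon_entropy_itinerary_add_le[OF M T P] H(1)
    by (intro subadditive_imp_convergent) (auto simp: H_def)
  then obtain L where L: "(\<lambda>n. H n / real n) \<longlonglongrightarrow> L" by (auto simp: convergent_def)
  \<comment> \<open>At \<open>n = 0\<close> both sides vanish because division by zero yields zero.\<close>
  have "partition_entropy M (iterated_join M T P n) / real n = H n / real n" for n
    using iterated_join_eq_fibres[OF T, of P n] partition_entropy_fibres[of M "?N n"] P
    by (cases "n = 0") (auto simp: H_def finite_measurable_partition_def)
  then have entropy_eq: "metric_entropy M T P = L"
    unfolding metric_entropy_def using L by (simp only: limI)
  have "AE x in M. \<forall>n. 0 < p n x"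
    unfolding AE_all_countable p_def by (intro allI AE_simple_function_fibre_pos[OF sf M])
  moreover have "AE x in M. \<exists>c>0. \<forall>n>0. p n x \<le> exp (- (real n / a)) / c"
    unfolding p_def using assms by (intro AE_itinerary_fibre_le[OF M]) auto
  ultimately have "AE x in M. ennreal (1 / a) \<le> liminf (\<lambda>n. ennreal (- ln (p n x) / real n))"
  proof eventually_elim
    case (elim x)
    then obtain c where c: "0 < c" "\<And>n. 0 < n \<Longrightarrow> p n x \<le> exp (- (real n / a)) / c" by blast
    have "1 / a + ln c / real n \<le> - ln (p n x) / real n" if n: "0 < n" for n
    proof -
      have "ln (p n x) \<le> ln (exp (- (real n / a)) / c)"
        using elim c n by (intro ln_mono) auto
      also have "\<dots> = - (real n / a) - ln c" using c by (simp add: ln_div)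
      finally have "(real n / a + ln c) / real n \<le> - ln (p n x) / real n"
        by (intro divide_right_mono) auto
      then show ?thesis using n by (simp add: add_divide_distrib)
    qed
    then have "liminf (\<lambda>n. ennreal (1 / a + ln c / real n)) \<le> liminf (\<lambda>n. ennreal (- ln (p n x) / real n))"
      by (intro Liminf_mono eventually_sequentiallyI[of 1] ennreal_leI) simp
    moreover have "(\<lambda>n. 1 / a + ln c / real n) \<longlonglongrightarrow> 1 / a + 0"
      by (intro tendsto_intros lim_const_over_n)
    then have "(\<lambda>n. 1 / a + ln c / real n) \<longlonglongrightarrow> 1 / a" by simp
    then have "liminf (\<lambda>n. ennreal (1 / a + ln c / real n)) = ennreal (1 / a)"
      by (intro lim_imp_Liminf tendsto_ennrealI trivial_limit_sequentially)
    ultimately show ?case by simp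
  qed
  \<comment> \<open>The constant \<open>c\<close> was chosen separately for each \<open>x\<close>; it has disappeared in the lower
    limit, which is a measurable function and can be integrated.\<close>
  then have "(\<integral>\<^sup>+x. ennreal (1 / a) \<partial>M) \<le> (\<integral>\<^sup>+x. liminf (\<lambda>n. ennreal (- ln (p n x) / real n)) \<partial>M)"
    by (rule nn_integral_mono_AE)
  also have "\<dots> \<le> liminf (\<lambda>n. \<integral>\<^sup>+x. ennreal (- ln (p n x) / real n) \<partial>M)"
    by (intro nn_integral_liminf borel_measurable_simple_function p_sf)
  also have "(\<lambda>n. \<integral>\<^sup>+x. ennreal (- ln (p n x) / real n) \<partial>M) = (\<lambda>n. ennreal (H n / real n))"
  proof
    fix n
    show "(\<integral>\<^sup>+x. ennreal (- ln (p n x) / real n) \<partial>M) = ennreal (H n / real n)"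
    proof (cases "n = 0")
      case False
      have nn: "0 \<le> - ln (p n x)" for x
        using prob_le_1 by (cases "p n x = 0") (auto simp: p_def less_le measure_nonneg)
      have "(\<integral>\<^sup>+x. ennreal (- ln (p n x) / real n) \<partial>M) =
          (\<integral>\<^sup>+x. ennreal (- ln (p n x)) / ennreal (real n) \<partial>M)"
        using False nn by (intro nn_integral_cong) (subst divide_ennreal, simp_all)
      also have "\<dots> = ennreal (H n) / ennreal (real n)"
        unfolding H(2) by (intro nn_integral_divide borel_measurable_simple_function p_sf)
      also have "\<dots> = ennreal (H n / real n)" using False H(1) by (subst divide_ennreal) auto
      finally show ?thesis .
    qed simp
  qed
  also have "liminf (\<lambda>n. ennreal (H n / real n)) = ennreal L"
    by (intro lim_imp_Liminf tendsto_ennrealI L trivial_limit_sequentially)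
  finally have "ennreal (1 / a) \<le> ennreal L" by (simp add: emeasure_space_1)
  moreover have "0 \<le> L" by (rule LIMSEQ_le_const[OF L]) (auto intro!: exI[of _ 0] divide_nonneg_nonneg H)
  ultimately show ?thesis by (simp add: entropy_eq ennreal_le_iff)
qed

end
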